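(* Let $N$ be a positive integer which is not a perfect square, let $p$ be an integer with $p^2<N$, let $q$ be a positive integer dividing $N-p^2$, and put $\alpha=\frac{\sqrt N+p}{q}$. Let $(x_n)$, $(c_n)$, $(d_n)$, $(s_n)$ be the sequences associated with the left-positive path (LPP) of $\alpha$, and let $T$ be the least period of the LPP. Assume $x_m=-\alpha^*$ for a certain positive integer $m$. Then: 1. The list $(c_0,c_1,\dots,c_{m-1},c_m)$ is antisymmetric (that is, $c_{m-j}=-c_j$ for all $0\le j\le m$) and the list $(d_0,d_1,\dots,d_{m-1},d_m)$ is symmetric (that is, $d_{m-j}=d_j$ for all $0\le j\le m$). In particular, if $m=2k$ is even then $c_k=0$ and $x_k=\frac{\sqrt N}{d_k}$. 2. The list $(s_0,s_1,\dots,s_{m-1})$ is a palindrome: for every integer $j\in\{0,1,\dots,m-1\}$, $s_{m-1-j}=s_j$. 3. For every $n\in\{0,1,\dots,T\}$, there exists $k(n)\in\{0,1,\dots,T\}$ such that $-x_n^*=x_{k(n)}$.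
   Context: The Calkin-Wilf tree of $\alpha$ is the infinite binary tree whose root is labeled $\alpha$ and in which every vertex labeled $x$ has a left child labeled $\frac{x}{x+1}$ and a right child labeled $x+1$ (since $\alpha>0$, all labels are positive). Each vertex carries a triple $(\varepsilon,c,d)$ with $\varepsilon\in\{-1,1\}$, $c$ an integer, $d$ a positive integer dividing $N-c^2$, and label equal to $\frac{\varepsilon\sqrt N+c}{d}$, defined as follows. The root has triple $(1,p,q)$. If a vertex has triple $(\varepsilon,c,d)$, its right child has triple $(\varepsilon,c+d,d)$; its left child has triple $\left(-\varepsilon,\frac{N-c^2}{d}-c,\frac{N-(c+d)^2}{d}\right)$ if $N-(c+d)^2>0$, and $\left(\varepsilon,c-\frac{N-c^2}{d},\frac{(c+d)^2-N}{d}\right)$ otherwise. The left-positive path (LPP) of $\alpha$ is the infinite descending path which starts at the root and which, from each vertex, goes to the left child if the value of $\varepsilon$ for that left child is $1$, and to the right child otherwise. Along the LPP one always has $\varepsilon=1$. $x_n$ denotes the label of the $n$-th vertex of the LPP, with $x_0=\alpha$, and $c_n,d_n$ are the values of $c,d$ at that vertex, so $x_n=\frac{\sqrt N+c_n}{d_n}$. Put $s_n=\ell$ if the step from $x_n$ to $x_{n+1}$ goes to the left child, and $s_n=r$ if it goes to the right child. The sequence $(x_n)$ is purely periodic, and $T$ denotes its least period, i.e. the least positive integer such that $x_T=\alpha$. For rational numbers $a,b$, the algebraic conjugate of $x=a\sqrt N+b$ is $x^*=-a\sqrt N+b$. *)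

theory Defs
  imports Complex_Main
begin

text \<open>
  A vertex of the infinite binary tree is the list of turns leading to it from the root,
  with the most recent turn first: the root is \<open>[]\<close>, and the left and right children of \<open>v\<close> are
  \<open>To_Left # v\<close> and \<open>To_Right # v\<close>.
\<close>

datatype turn = To_Left | To_Right

type_synonym vertex = "turn list"

primrec cw_label :: "real \<Rightarrow> vertex \<Rightarrow> real" where
  "cw_label \<alpha> [] = \<alpha>"
| "cw_label \<alpha> (t # v) =
     (let x = cw_label \<alpha> v in
      case t of To_Left \<Rightarrow> x / (x + 1) | To_Right \<Rightarrow> x + 1)"

type_synonym triple = "int \<times> int \<times> int"

text \<open>
  The invariant that \<open>d\<close> is positive and divides \<open>N - c\<^sup>2\<close>, which holds at the root and is passed on
  to both children, makes every integer division below exact.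
\<close>

definition left_triple :: "int \<Rightarrow> triple \<Rightarrow> triple" where
  "left_triple N = (\<lambda>(\<epsilon>, c, d).
     if N - (c + d)\<^sup>2 > 0
     then (- \<epsilon>, (N - c\<^sup>2) div d - c, (N - (c + d)\<^sup>2) div d)
     else (\<epsilon>, c - (N - c\<^sup>2) div d, ((c + d)\<^sup>2 - N) div d))"

definition right_triple :: "triple \<Rightarrow> triple" where
  "right_triple = (\<lambda>(\<epsilon>, c, d). (\<epsilon>, c + d, d))"

primrec cw_triple :: "int \<Rightarrow> int \<Rightarrow> int \<Rightarrow> vertex \<Rightarrow> triple" where
  "cw_triple N p q [] = (1, p, q)"
| "cw_triple N p q (t # v) =
     (case t of To_Left \<Rightarrow> left_triple N (cw_triple N p q v)
              | To_Right \<Rightarrow> right_triple (cw_triple N p q v))"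

definition vertex_eps :: "int \<Rightarrow> int \<Rightarrow> int \<Rightarrow> vertex \<Rightarrow> int" where
  "vertex_eps N p q v = fst (cw_triple N p q v)"

definition lpp_turn :: "int \<Rightarrow> int \<Rightarrow> int \<Rightarrow> vertex \<Rightarrow> turn" where
  "lpp_turn N p q v = (if vertex_eps N p q (To_Left # v) = 1 then To_Left else To_Right)"

primrec lpp :: "int \<Rightarrow> int \<Rightarrow> int \<Rightarrow> nat \<Rightarrow> vertex" where
  "lpp N p q 0 = []"
| "lpp N p q (Suc n) = lpp_turn N p q (lpp N p q n) # lpp N p q n"

definition quad_surd :: "int \<Rightarrow> int \<Rightarrow> int \<Rightarrow> real" where
  "quad_surd N p q = (sqrt (of_int N) + of_int p) / of_int q"

definition lpp_x :: "int \<Rightarrow> int \<Rightarrow> int \<Rightarrow> nat \<Rightarrow> real" where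
  "lpp_x N p q n = cw_label (quad_surd N p q) (lpp N p q n)"

definition lpp_c :: "int \<Rightarrow> int \<Rightarrow> int \<Rightarrow> nat \<Rightarrow> int" where
  "lpp_c N p q n = fst (snd (cw_triple N p q (lpp N p q n)))"

definition lpp_d :: "int \<Rightarrow> int \<Rightarrow> int \<Rightarrow> nat \<Rightarrow> int" where
  "lpp_d N p q n = snd (snd (cw_triple N p q (lpp N p q n)))"

definition lpp_s :: "int \<Rightarrow> int \<Rightarrow> int \<Rightarrow> nat \<Rightarrow> turn" where
  "lpp_s N p q n = lpp_turn N p q (lpp N p q n)"

definition lpp_period :: "int \<Rightarrow> int \<Rightarrow> int \<Rightarrow> nat" where
  "lpp_period N p q = (LEAST T. T > 0 \<and> lpp_x N p q T = quad_surd N p q)"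

text \<open>
  The representation \<open>x = a \<surd>N + b\<close> with rational \<open>a\<close>, \<open>b\<close> is unique when \<open>N\<close> is not a perfect
  square; for \<open>x\<close> outside \<open>\<rat>(\<surd>N)\<close> the value is unspecified.
\<close>

definition alg_conj :: "int \<Rightarrow> real \<Rightarrow> real" where
  "alg_conj N x = (THE y. \<exists>a\<in>\<rat>. \<exists>b\<in>\<rat>.
     x = a * sqrt (of_int N) + b \<and> y = - a * sqrt (of_int N) + b)"

end

theory Submission
  imports Defs
begin

text \<open>
  On triples \<open>(c, d, e)\<close> with \<open>c\<^sup>2 + d e = N\<close> and \<open>d, e > 0\<close>, the LPP step is conjugate to its own
  inverse under the involution \<open>(c, d, e) \<mapsto> (-c, d, e)\<close>, which corresponds to \<open>x \<mapsto> -x\<^sup>*\<close>, and the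
  turn taken is preserved. So once the LPP meets the mirror image of its start, it retraces itself
  in reverse from there. As there are finitely many such triples, the LPP is periodic, and moving
  the meeting point by multiples of the period mirrors every vertex.
\<close>

section \<open>Irrationality of the square root and conjugation of surds\<close>

lemma sqrt_notin_Rats:
  fixes N :: int
  assumes "N > 0" and "\<nexists>k :: int. N = k\<^sup>2"
  shows "sqrt (of_int N) \<notin> \<rat>"
proof
  assume "sqrt (of_int N) \<in> \<rat>"
  then obtain a b :: nat where "b \<noteq> 0" and ab: "\<bar>sqrt (of_int N)\<bar> = real a / real b" and "coprime a b"
    by (rule Rats_abs_nat_div_natE)
  have "real_of_int N = (real a / real b)\<^sup>2"
    using assms(1) by (simp flip: ab)
  then have "real_of_int (N * (int b)\<^sup>2) = real_of_int ((int a)\<^sup>2)"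
    using \<open>b \<noteq> 0\<close> by (simp add: field_simps)
  then have eq: "N * (int b)\<^sup>2 = (int a)\<^sup>2"
    by linarith
  then have "int b dvd (int a)\<^sup>2"
    by (metis dvd_mult dvd_refl power2_eq_square)
  moreover have "coprime (int b) ((int a)\<^sup>2)"
    using \<open>coprime a b\<close> by (simp add: coprime_commute)
  ultimately have "is_unit (int b)"
    by (meson coprime_common_divisor dvd_refl)
  then have "N = (int a)\<^sup>2"
    using eq by simp
  with assms(2) show False by blast
qed

lemma Rats_comb_sqrt_eq_iff:
  assumes "r \<notin> \<rat>" "a \<in> \<rat>" "b \<in> \<rat>" "a' \<in> \<rat>" "b' \<in> \<rat>"
  shows "a * r + b = a' * r + b' \<longleftrightarrow> a = a' \<and> b = (b' :: real)"
proof
  assume eq: "a * r + b = a' * r + b'"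
  have "a = a'"
  proof (rule ccontr)
    assume "a \<noteq> a'"
    with eq have "r = (b' - b) / (a - a')"
      by (simp add: field_simps)
    with assms show False by auto
  qed
  with eq show "a = a' \<and> b = b'" by simp
qed auto

lemma alg_conj_eq:
  assumes "sqrt (of_int N) \<notin> \<rat>" "a \<in> \<rat>" "b \<in> \<rat>"
  shows "alg_conj N (a * sqrt (of_int N) + b) = - a * sqrt (of_int N) + b"
  unfolding alg_conj_def
  using assms by (intro the_equality) (auto simp: Rats_comb_sqrt_eq_iff)

lemma quad_surd_alt: "quad_surd N c d = (1 / of_int d) * sqrt (of_int N) + of_int c / of_int d"
  by (simp add: quad_surd_def add_divide_distrib)

text \<open>Turns equations between labels into equations between integer pairs, so the hypothesis
  on \<open>x_m\<close> and the definition of the period can be read off from forms.\<close>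

lemma quad_surd_eq_iff:
  assumes "sqrt (of_int N) \<notin> \<rat>" "d > 0" "d' > 0"
  shows "quad_surd N c d = quad_surd N c' d' \<longleftrightarrow> c = c' \<and> d = d'"
  unfolding quad_surd_alt using assms by (subst Rats_comb_sqrt_eq_iff) auto

lemma uminus_alg_conj_quad_surd:
  assumes "sqrt (of_int N) \<notin> \<rat>"
  shows "- alg_conj N (quad_surd N c d) = quad_surd N (- c) d"
  unfolding quad_surd_alt using assms by (subst alg_conj_eq) auto

section \<open>Forms, the step map and its reversal\<close>

text \<open>
  A vertex on the LPP is encoded by \<open>(c, d, e)\<close> with \<open>e = (N - c\<^sup>2) / d\<close>, which makes the step
  piecewise linear; \<open>N - (c + d)\<^sup>2 = d (e - 2 c - d)\<close> turns the case distinction into a comparison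
  of \<open>d + 2 c\<close> with \<open>e\<close>.
\<close>

type_synonym form = "int \<times> int \<times> int"

definition forms :: "int \<Rightarrow> form set" where
  "forms N = {(c, d, e). d > 0 \<and> e > 0 \<and> c\<^sup>2 + d * e = N}"

definition turn_of :: "form \<Rightarrow> turn" where
  "turn_of = (\<lambda>(c, d, e). if d + 2 * c < e then To_Right else To_Left)"

definition step :: "form \<Rightarrow> form" where
  "step = (\<lambda>(c, d, e). if d + 2 * c < e then (c + d, d, e - 2 * c - d)
                        else (c - e, d + 2 * c - e, e))"

definition flip :: "form \<Rightarrow> form" where
  "flip = (\<lambda>(c, d, e). (- c, d, e))"

lemma flip_flip [simp]: "flip (flip X) = X"
  by (simp add: flip_def split: prod.splits)

lemma fst_flip: "fst (flip X) = - fst X"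
  and fst_snd_flip: "fst (snd (flip X)) = fst (snd X)"
  by (cases X; simp add: flip_def)+

lemma flip_in_forms: "X \<in> forms N \<Longrightarrow> flip X \<in> forms N"
  by (auto simp: flip_def forms_def)

text \<open>Equality would put a zero in the form after a step; excluding it keeps the new entry
  strictly positive.\<close>

lemma forms_neq:
  assumes "\<nexists>k :: int. N = k\<^sup>2" "(c, d, e) \<in> forms N"
  shows "d + 2 * c \<noteq> e"
proof
  assume "d + 2 * c = e"
  with assms(2) have "N = (c + d)\<^sup>2"
    by (auto simp: forms_def power2_eq_square algebra_simps)
  with assms(1) show False by blast
qed

lemma step_in_forms:
  assumes "\<nexists>k :: int. N = k\<^sup>2" "X \<in> forms N"
  shows "step X \<in> forms N"
proof (cases X)
  case (fields c d e)
  with forms_neq assms have "d + 2 * c \<noteq> e" by blast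
  with assms(2) fields show ?thesis
    by (auto simp: forms_def step_def power2_eq_square algebra_simps)
qed

text \<open>The inverse of \<open>step\<close> is its conjugate by \<open>flip\<close>.\<close>

lemma flip_step_flip_step:
  assumes "X \<in> forms N"
  shows "flip (step (flip (step X))) = X"
  using assms by (cases X) (auto simp: forms_def step_def flip_def)

text \<open>After a right step and \<open>flip\<close>, the test for turning right reduces to
  \<open>0 < e\<close>; after a left step and \<open>flip\<close>, it reduces to
  \<open>d + e < e\<close>. Positivity of \<open>e\<close> and \<open>d\<close> therefore forces the
  same turn again.\<close>

lemma turn_of_flip_step:
  assumes "X \<in> forms N"
  shows "turn_of (flip (step X)) = turn_of X"
  using assms by (cases X) (auto simp: forms_def step_def flip_def turn_of_def)

section \<open>Finiteness, periodicity and orbits meeting their mirror image\<close>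

lemma finite_forms: "finite (forms N)"
proof (rule finite_subset)
  show "forms N \<subseteq> {- N..N} \<times> {0..N} \<times> {0..N}"
  proof
    fix X assume "X \<in> forms N"
    then obtain c d e where X: "X = (c, d, e)" and h: "d > 0" "e > 0" "c\<^sup>2 + d * e = N"
      by (auto simp: forms_def)
    have "\<bar>c\<bar> \<le> c\<^sup>2"
      using self_le_power[of "\<bar>c\<bar>" 2] by (cases "c = 0") auto
    moreover have "d \<le> d * e" "e \<le> d * e"
      using h by simp_all
    ultimately have "\<bar>c\<bar> \<le> N" "d \<le> N" "e \<le> N"
      using h by linarith+
    with h show "X \<in> {- N..N} \<times> {0..N} \<times> {0..N}"
      by (auto simp: X)
  qed
qed auto

lemma inj_on_step: "inj_on step (forms N)"
  by (rule inj_on_inverseI[where g = "flip \<circ> step \<circ> flip"]) (simp add: flip_step_flip_step)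

lemma funpow_step_in_forms:
  assumes "\<nexists>k :: int. N = k\<^sup>2" "X \<in> forms N"
  shows "(step ^^ n) X \<in> forms N"
  by (induction n) (use assms step_in_forms in auto)

text \<open>Finiteness makes the orbit repeat, and injectivity cancels the steps before the first of
  the two equal terms, so the orbit returns to \<open>X\<close> itself: the period has no
  preperiod.\<close>

lemma step_periodic:
  assumes "\<nexists>k :: int. N = k\<^sup>2" "X \<in> forms N"
  obtains T where "T > 0" "(step ^^ T) X = X"
proof -
  note in_forms = funpow_step_in_forms[OF assms]
  have "bij_betw step (forms N) (forms N)"
    unfolding bij_betw_def using assms(1) step_in_forms inj_on_step finite_forms
    by (metis endo_inj_surj image_subsetI)
  then have bij: "bij_betw (step ^^ i) (forms N) (forms N)" for i
    by (rule bij_betw_funpow)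
  have "\<not> inj (\<lambda>n. (step ^^ n) X)"
  proof
    assume "inj (\<lambda>n. (step ^^ n) X)"
    moreover have "finite (range (\<lambda>n. (step ^^ n) X))"
      by (rule finite_subset[OF _ finite_forms[of N]]) (use in_forms in auto)
    ultimately show False
      using finite_imageD infinite_UNIV_nat by blast
  qed
  then obtain i j where ij: "i < j" "(step ^^ i) X = (step ^^ j) X"
    unfolding inj_def by (metis linorder_neqE_nat)
  have "(step ^^ j) X = (step ^^ i) ((step ^^ (j - i)) X)"
    using ij(1) by (metis funpow_add le_add_diff_inverse less_imp_le_nat o_apply)
  then have "X = (step ^^ (j - i)) X"
    using ij(2) in_forms assms(2) bij_betw_imp_inj_on[OF bij[of i]] by (metis inj_onD)
  with ij(1) show ?thesis
    by (metis that zero_less_diff)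
qed

text \<open>Going one place back from index \<open>m - j\<close> applies the inverse of
  \<open>step\<close>, which is \<open>step\<close> seen through \<open>flip\<close>; hence the
  mirrored orbit runs forward while \<open>m - j\<close> runs backward.\<close>

lemma flip_orbit:
  assumes "\<nexists>k :: int. N = k\<^sup>2" "X \<in> forms N" "(step ^^ m) X = flip X" "j \<le> m"
  shows "(step ^^ (m - j)) X = flip ((step ^^ j) X)"
  using assms(4)
proof (induction j)
  case 0
  with assms(3) show ?case by simp
next
  case (Suc j)
  define Y where "Y = (step ^^ (m - Suc j)) X"
  have "step Y = (step ^^ (m - j)) X"
    using Suc.prems by (simp add: Y_def Suc_diff_Suc flip: funpow.simps(2) o_apply[of step])
  with Suc have "flip (step Y) = (step ^^ j) X" by simp
  moreover have "Y \<in> forms N"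
    using assms funpow_step_in_forms by (simp add: Y_def)
  ultimately show ?case
    using flip_step_flip_step[of Y N] by (simp add: Y_def)
qed

section \<open>The left-positive path as an orbit of the step map\<close>

lemma lpp_step:
  assumes "\<nexists>k :: int. N = k\<^sup>2" "(c, d, e) \<in> forms N"
    and "cw_triple N p q (lpp N p q n) = (1, c, d)" "lpp_x N p q n = quad_surd N c d"
    and "step (c, d, e) = (c', d', e')"
  shows "cw_triple N p q (lpp N p q (Suc n)) = (1, c', d')"
    and "lpp_x N p q (Suc n) = quad_surd N c' d'"
    and "lpp_s N p q n = turn_of (c, d, e)"
proof -
  have d: "d > 0" and e: "e > 0" and N: "N = c\<^sup>2 + d * e"
    using assms(2) by (auto simp: forms_def)
  have ne: "d + 2 * c \<noteq> e"
    using assms forms_neq by blast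
  have sq: "N - (c + d)\<^sup>2 = d * (e - 2 * c - d)" "(c + d)\<^sup>2 - N = d * (d + 2 * c - e)" "N - c\<^sup>2 = d * e"
    by (simp_all add: N power2_eq_square algebra_simps)
  have pos: "N - (c + d)\<^sup>2 > 0 \<longleftrightarrow> d + 2 * c < e"
    using d by (auto simp: sq zero_less_mult_iff)
  \<comment> \<open>The left child has sign \<open>-1\<close> exactly when
    \<open>d + 2 * c < e\<close>, so the path then turns right and its own sign stays
    \<open>1\<close> in both cases.\<close>
  have left: "left_triple N (1, c, d) =
      (if d + 2 * c < e then (- 1, e - c, e - 2 * c - d) else (1, c - e, d + 2 * c - e))"
    unfolding left_triple_def prod.case pos unfolding sq using d by simp
  show s: "lpp_s N p q n = turn_of (c, d, e)"
    using assms(3) by (simp add: lpp_s_def lpp_turn_def vertex_eps_def left turn_of_def)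
  then have s': "lpp_turn N p q (lpp N p q n) = turn_of (c, d, e)"
    by (simp add: lpp_s_def)
  show "cw_triple N p q (lpp N p q (Suc n)) = (1, c', d')"
    using assms(3,5) by (auto simp: s' turn_of_def step_def left right_triple_def split: if_splits)
  have x: "cw_label (quad_surd N p q) (lpp N p q n) = quad_surd N c d"
    using assms(4) by (simp add: lpp_x_def)
  show "lpp_x N p q (Suc n) = quad_surd N c' d'"
  proof (cases "d + 2 * c < e")
    case True
    have "quad_surd N (c + d) d = quad_surd N c d + 1"
      using d by (simp add: quad_surd_def field_simps)
    with True show ?thesis
      using assms(5) by (auto simp: lpp_x_def s' x turn_of_def step_def)
  next
    case False
    define r where "r = sqrt (of_int N)"
    have "N \<ge> 0" using d e N by simp
    then have r2: "r * r = of_int (c\<^sup>2 + d * e)" by (simp add: r_def flip: N)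
    \<comment> \<open>This bound keeps \<open>r + c + d\<close>, the numerator of
      \<open>x + 1\<close>, away from zero.\<close>
    have "\<bar>real_of_int c\<bar> \<le> r"
      unfolding r_def by (rule real_le_rsqrt) (use N d e in simp)
    then have rcd: "r + of_int c + of_int d > 0" using d by linarith
    have d': "real_of_int d + 2 * of_int c - of_int e > 0"
      using False ne by linarith
    have "lpp_x N p q (Suc n) = quad_surd N c d / (quad_surd N c d + 1)"
      using False by (simp add: lpp_x_def s' x turn_of_def Let_def)
    also have "quad_surd N c d + 1 = (r + of_int c + of_int d) / of_int d"
      using d by (simp add: quad_surd_def r_def field_simps)
    also have "quad_surd N c d / \<dots> = (r + of_int c) / (r + of_int c + of_int d)"
      using d by (simp add: quad_surd_def r_def)
    \<comment> \<open>Cross-multiplying leaves \<open>r * r = c * c + d * e\<close>, which is the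
      defining equation of the form.\<close>
    also have "\<dots> = (r + of_int (c - e)) / of_int (d + 2 * c - e)"
      using rcd d' r2 by (simp add: frac_eq_eq algebra_simps power2_eq_square)
    finally show ?thesis
      using False assms(5) by (auto simp: step_def quad_surd_def r_def)
  qed
qed

text \<open>The third entry is determined by the other two, since \<open>d * e = N - c * c\<close>
  and \<open>d\<close> is nonzero.\<close>

lemma forms_eq_iff:
  assumes "X \<in> forms N" "Y \<in> forms N"
  shows "X = Y \<longleftrightarrow> fst X = fst Y \<and> fst (snd X) = fst (snd Y)"
  using assms by (cases X; cases Y) (auto simp: forms_def)

context
  fixes N p q :: int
  assumes not_square: "\<nexists>k :: int. N = k\<^sup>2"
    and root_in_forms: "(p, q, (N - p\<^sup>2) div q) \<in> forms N"
begin

definition lpp_form :: "nat \<Rightarrow> form" where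
  "lpp_form n = (step ^^ n) (p, q, (N - p\<^sup>2) div q)"

lemma lpp_form_0: "lpp_form 0 = (p, q, (N - p\<^sup>2) div q)"
  by (simp add: lpp_form_def)

lemma lpp_form_Suc: "lpp_form (Suc n) = step (lpp_form n)"
  by (simp add: lpp_form_def)

lemma lpp_form_in_forms: "lpp_form n \<in> forms N"
  unfolding lpp_form_def using funpow_step_in_forms[OF not_square root_in_forms] .

lemma lpp_form_correct:
  assumes "lpp_form n = (c, d, e)"
  shows "cw_triple N p q (lpp N p q n) = (1, c, d) \<and> lpp_x N p q n = quad_surd N c d"
  using assms
proof (induction n arbitrary: c d e)
  case 0
  then show ?case
    by (simp add: lpp_form_0 lpp_x_def)
next
  case (Suc n)
  obtain c0 d0 e0 where "lpp_form n = (c0, d0, e0)"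
    by (rule prod_cases3)
  with Suc lpp_step[OF not_square, of c0 d0 e0 p q n c d e] lpp_form_in_forms[of n] show ?case
    by (simp add: lpp_form_Suc)
qed

lemma lpp_c_eq: "lpp_c N p q n = fst (lpp_form n)"
  and lpp_d_eq: "lpp_d N p q n = fst (snd (lpp_form n))"
  using lpp_form_correct[of n] by (cases "lpp_form n"; simp add: lpp_c_def lpp_d_def)+

lemma lpp_x_eq: "lpp_x N p q n = quad_surd N (lpp_c N p q n) (lpp_d N p q n)"
  using lpp_form_correct[of n] by (cases "lpp_form n") (simp add: lpp_c_eq lpp_d_eq)

lemma lpp_s_eq: "lpp_s N p q n = turn_of (lpp_form n)"
proof -
  obtain c d e where X: "lpp_form n = (c, d, e)"
    by (rule prod_cases3)
  obtain c' d' e' where "step (c, d, e) = (c', d', e')"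
    by (rule prod_cases3)
  with lpp_step(3)[OF not_square] lpp_form_correct[OF X] lpp_form_in_forms[of n] X show ?thesis
    by metis
qed

lemma lpp_form_eq_iff:
  assumes "sqrt (of_int N) \<notin> \<rat>" "X \<in> forms N"
  shows "lpp_form n = X \<longleftrightarrow> lpp_x N p q n = quad_surd N (fst X) (fst (snd X))"
proof -
  have "fst (snd Y) > 0" if "Y \<in> forms N" for Y
    using that by (auto simp: forms_def)
  with assms lpp_form_in_forms show ?thesis
    by (simp add: lpp_x_eq quad_surd_eq_iff forms_eq_iff[OF lpp_form_in_forms assms(2)] lpp_c_eq lpp_d_eq)
qed

end

section \<open>Symmetries of the path\<close>

theorem corollary2:
  fixes N p q :: int and m :: nat
  assumes "N > 0" and "\<nexists>k :: int. N = k\<^sup>2"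
    and "p\<^sup>2 < N"
    and "q > 0" and "q dvd N - p\<^sup>2"
    and "m > 0" and "lpp_x N p q m = - alg_conj N (quad_surd N p q)"
  shows "(\<forall>j\<le>m. lpp_c N p q (m - j) = - lpp_c N p q j)
       \<and> (\<forall>j\<le>m. lpp_d N p q (m - j) = lpp_d N p q j)
       \<and> (\<forall>k. m = 2 * k \<longrightarrow>
             lpp_c N p q k = 0 \<and> lpp_x N p q k = sqrt (of_int N) / of_int (lpp_d N p q k))
       \<and> (\<forall>j<m. lpp_s N p q (m - 1 - j) = lpp_s N p q j)
       \<and> (\<forall>n\<le>lpp_period N p q. \<exists>k\<le>lpp_period N p q.
             - alg_conj N (lpp_x N p q n) = lpp_x N p q k)"
proof -
  have irr: "sqrt (of_int N) \<notin> \<rat>"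
    using sqrt_notin_Rats assms(1,2) .
  have root: "(p, q, (N - p\<^sup>2) div q) \<in> forms N"
    using assms(3-5) by (simp add: forms_def pos_imp_zdiv_pos_iff zdvd_imp_le)
  note ctx = assms(2) root
  define X where "X = lpp_form N p q"
  have funpow: "X n = (step ^^ n) (X 0)" for n
    unfolding X_def by (simp add: lpp_form_def[OF ctx])
  have X_in: "X n \<in> forms N" for n
    unfolding X_def by (rule lpp_form_in_forms[OF ctx])
  have X_0: "X 0 = (p, q, (N - p\<^sup>2) div q)"
    unfolding X_def by (rule lpp_form_0[OF ctx])
  have X_Suc: "X (Suc n) = step (X n)" for n
    unfolding X_def by (rule lpp_form_Suc[OF ctx])
  have c: "lpp_c N p q n = fst (X n)" and d: "lpp_d N p q n = fst (snd (X n))" for n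
    unfolding X_def by (rule lpp_c_eq[OF ctx] lpp_d_eq[OF ctx])+
  have x: "lpp_x N p q n = quad_surd N (fst (X n)) (fst (snd (X n)))" for n
    by (simp add: lpp_x_eq[OF ctx] c d)
  have s: "lpp_s N p q n = turn_of (X n)" for n
    unfolding X_def by (rule lpp_s_eq[OF ctx])
  have X_eq_iff: "X n = Y \<longleftrightarrow> lpp_x N p q n = quad_surd N (fst Y) (fst (snd Y))"
    if "Y \<in> forms N" for n Y
    unfolding X_def using lpp_form_eq_iff[OF ctx irr that] .
  have "X m = flip (X 0)"
    unfolding X_eq_iff[OF flip_in_forms[OF X_in]]
    using assms(7) by (simp add: fst_flip fst_snd_flip X_0 uminus_alg_conj_quad_surd[OF irr])
  \<comment> \<open>The meeting index is left open: it is used below both for \<open>m\<close> and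
    for \<open>m\<close> shifted by a multiple of the period.\<close>
  note orbit = flip_orbit[OF assms(2) X_in[of 0], folded funpow]
  have mirror: "X (m - j) = flip (X j)" if "j \<le> m" for j
    using orbit[OF \<open>X m = flip (X 0)\<close> that] .
  have anti_c: "lpp_c N p q (m - j) = - lpp_c N p q j" if "j \<le> m" for j
    using mirror[OF that] by (simp add: c fst_flip)
  have sym_d: "lpp_d N p q (m - j) = lpp_d N p q j" if "j \<le> m" for j
    using mirror[OF that] by (simp add: d fst_snd_flip)
  have mid: "lpp_c N p q k = 0 \<and> lpp_x N p q k = sqrt (of_int N) / of_int (lpp_d N p q k)"
    if "m = 2 * k" for k
  proof -
    have "lpp_c N p q k = 0"
      using anti_c[of k] that by simp
    then show ?thesis
      by (simp add: x quad_surd_def c d)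
  qed
  have pal: "lpp_s N p q (m - 1 - j) = lpp_s N p q j" if "j < m" for j
  proof -
    \<comment> \<open>The turn with index \<open>m - 1 - j\<close> is the step that arrives at
      \<open>X (m - j)\<close>, the mirror image of \<open>X j\<close>.\<close>
    have "Suc (m - 1 - j) = m - j"
      using that by simp
    then have "flip (step (X (m - 1 - j))) = X j"
      using mirror[of j] that by (metis X_Suc flip_flip less_imp_le)
    then show ?thesis
      using turn_of_flip_step[OF X_in[of "m - 1 - j"]] by (simp add: s)
  qed
  define T where "T = lpp_period N p q"
  have root_period: "X T' = X 0 \<longleftrightarrow> lpp_x N p q T' = quad_surd N p q" for T'
    using X_eq_iff[OF X_in[of 0], of T'] by (simp add: X_0)
  obtain T' where "T' > 0" "X T' = X 0"
    using step_periodic[OF assms(2) X_in[of 0], folded funpow] .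
  then have T: "T > 0 \<and> X T = X 0"
    unfolding T_def lpp_period_def root_period by (intro LeastI) simp
  have X_mod: "X (n mod T) = X n" for n
    using T funpow_mod_eq[of T step "X 0" n, folded funpow] by simp
  have conj: "\<exists>k\<le>T. - alg_conj N (lpp_x N p q n) = lpp_x N p q k" if "n \<le> T" for n
  proof -
    \<comment> \<open>Since \<open>n\<close> may exceed \<open>m\<close>, the meeting index is moved
      forward by \<open>n\<close> periods; \<open>T > 0\<close> makes this far enough.\<close>
    have le: "n \<le> m + T * n"
      using T by (simp add: trans_le_add2)
    have "X (m + T * n) = X m"
      using X_mod[of "m + T * n"] X_mod[of m] by simp
    with \<open>X m = flip (X 0)\<close> have "X (m + T * n - n) = flip (X n)"
      by (intro orbit[OF _ le]) simp
    \<comment> \<open>Reducing modulo \<open>T\<close> brings the witness into the required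
      range.\<close>
    then have "X ((m + T * n - n) mod T) = flip (X n)"
      by (simp add: X_mod)
    then have "- alg_conj N (lpp_x N p q n) = lpp_x N p q ((m + T * n - n) mod T)"
      by (simp add: x uminus_alg_conj_quad_surd[OF irr] fst_flip fst_snd_flip)
    then show ?thesis
      using T by (meson mod_less_divisor order_less_imp_le)
  qed
  show ?thesis
    using anti_c sym_d mid pal conj unfolding T_def by blast
qed

end
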